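(* Let $V$ be a Euclidean Jordan algebra with unit element $e$ and symmetric cone $K$, and let $L$ be a linear transformation on $V$ with $v(L)=0$. Then $L$ is completely mixed if and only if $v(L+P_c)>0$ for every primitive idempotent $c$ in $V$.
   Context: A Euclidean Jordan algebra $(V,\circ,\langle\cdot,\cdot\rangle)$ is a finite dimensional real inner product space with a commutative bilinear product $\circ$ and unit element $e$ satisfying $x\circ(x^2\circ y)=x^2\circ(x\circ y)$ and $\langle x\circ y,z\rangle=\langle y,x\circ z\rangle$, where $x^2=x\circ x$. An element $c$ is an idempotent if $c^2=c$; it is a primitive idempotent if it is nonzero and is not a sum of two nonzero idempotents. A Jordan frame is a set $\{e_1,\dots,e_n\}$ of mutually orthogonal primitive idempotents with sum $e$; all Jordan frames have the same number $n$ of elements, the rank of $V$. Every $x\in V$ has a spectral decomposition $x=x_1e_1+\cdots+x_ne_n$ with $\{e_1,\dots,e_n\}$ a Jordan frame and $x_i\in\mathbb{R}$ the eigenvalues of $x$; $\operatorname{tr}(x)=x_1+\cdots+x_n$. The inner product is assumed to be the trace inner product $\langle x,y\rangle=\operatorname{tr}(x\circ y)$. The symmetric cone is $K=\{x\circ x:x\in V\}$, which is self-dual: $x\in K\Leftrightarrow\langle x,y\rangle\ge 0$ for all $y\in K$. $K^\circ$ denotes its interior; $e\in K^\circ$. For $c\in V$ the quadratic representation is $P_c(x)=2c\circ(c\circ x)-c^2\circ x$. Linear game (with $e$ the unit element): let $\Delta(e)=\{x\in K:\langle x,e\rangle=1\}$. For a linear $L:V\to V$, a pair $(\overline{x},\overline{y})\in\Delta(e)\times\Delta(e)$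 is an optimal strategy pair if $\langle L(x),\overline{y}\rangle\le\langle L(\overline{x}),\overline{y}\rangle\le\langle L(\overline{x}),y\rangle$ for all $x,y\in\Delta(e)$. Such pairs exist, and the value is $v(L)=v(L,e)=\langle L(\overline{x}),\overline{y}\rangle=\max_{x\in\Delta(e)}\min_{y\in\Delta(e)}\langle L(x),y\rangle$. $L$ is completely mixed if for every optimal strategy pair $(\overline{x},\overline{y})$ both $\overline{x},\overline{y}\in K^\circ$. *)

theory Defs
  imports "HOL-Analysis.Analysis"
begin

text \<open>
  The algebra is carried by a type of class \<open>euclidean_space\<close>, i.e. a nonzero finite-dimensional
  real inner product space with inner product \<open>\<bullet>\<close>; \<open>p x y\<close> is the Jordan product and \<open>e\<close> its unit.
\<close>

locale euclidean_jordan_algebra =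
  fixes p :: "'a::euclidean_space \<Rightarrow> 'a \<Rightarrow> 'a" and e :: 'a
  assumes bilinear: "bilinear p"
    and commute: "p x y = p y x"
    and unit: "p e x = x"
    and jordan_identity: "p x (p (p x x) y) = p (p x x) (p x y)"
    and inner_associative: "p x y \<bullet> z = y \<bullet> p x z"

definition idempotent :: "('a \<Rightarrow> 'a \<Rightarrow> 'a) \<Rightarrow> 'a \<Rightarrow> bool" where
  "idempotent p c \<longleftrightarrow> p c c = c"

definition primitive_idempotent :: "('a::euclidean_space \<Rightarrow> 'a \<Rightarrow> 'a) \<Rightarrow> 'a \<Rightarrow> bool" where
  "primitive_idempotent p c \<longleftrightarrow> idempotent p c \<and> c \<noteq> 0 \<and>
     \<not> (\<exists>a b. idempotent p a \<and> a \<noteq> 0 \<and> idempotent p b \<and> b \<noteq> 0 \<and> c = a + b)"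

text \<open>Orthogonality of idempotents \<open>c\<close>, \<open>d\<close> is taken in the algebraic sense \<open>p c d = 0\<close>.\<close>

definition jordan_frame :: "('a::euclidean_space \<Rightarrow> 'a \<Rightarrow> 'a) \<Rightarrow> 'a \<Rightarrow> 'a set \<Rightarrow> bool" where
  "jordan_frame p e F \<longleftrightarrow> finite F \<and> (\<forall>c\<in>F. primitive_idempotent p c) \<and>
     (\<forall>c\<in>F. \<forall>d\<in>F. c \<noteq> d \<longrightarrow> p c d = 0) \<and> \<Sum>F = e"

text \<open>
  The sum of the eigenvalues in a spectral decomposition of \<open>x\<close>. In a Euclidean Jordan algebra
  every \<open>x\<close> has a spectral decomposition and this sum does not depend on it, so the definite
  description denotes.
\<close>

definition jordan_trace :: "('a::euclidean_space \<Rightarrow> 'a \<Rightarrow> 'a) \<Rightarrow> 'a \<Rightarrow> 'a \<Rightarrow> real" where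
  "jordan_trace p e x =
     (THE t. \<exists>F r. jordan_frame p e F \<and> x = (\<Sum>c\<in>F. r c *\<^sub>R c) \<and> t = (\<Sum>c\<in>F. r c))"

definition trace_inner_product :: "('a::euclidean_space \<Rightarrow> 'a \<Rightarrow> 'a) \<Rightarrow> 'a \<Rightarrow> bool" where
  "trace_inner_product p e \<longleftrightarrow> (\<forall>x y. x \<bullet> y = jordan_trace p e (p x y))"

definition symmetric_cone :: "('a \<Rightarrow> 'a \<Rightarrow> 'a) \<Rightarrow> 'a set" where
  "symmetric_cone p = {p x x |x. True}"

definition quad_rep :: "('a::euclidean_space \<Rightarrow> 'a \<Rightarrow> 'a) \<Rightarrow> 'a \<Rightarrow> 'a \<Rightarrow> 'a" where
  "quad_rep p c x = 2 *\<^sub>R p c (p c x) - p (p c c) x"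

definition strategies :: "('a::euclidean_space \<Rightarrow> 'a \<Rightarrow> 'a) \<Rightarrow> 'a \<Rightarrow> 'a set" where
  "strategies p e = {x \<in> symmetric_cone p. x \<bullet> e = 1}"

definition optimal_pair ::
    "('a::euclidean_space \<Rightarrow> 'a \<Rightarrow> 'a) \<Rightarrow> 'a \<Rightarrow> ('a \<Rightarrow> 'a) \<Rightarrow> 'a \<Rightarrow> 'a \<Rightarrow> bool" where
  "optimal_pair p e L x' y' \<longleftrightarrow> x' \<in> strategies p e \<and> y' \<in> strategies p e \<and>
     (\<forall>x\<in>strategies p e. \<forall>y\<in>strategies p e. L x \<bullet> y' \<le> L x' \<bullet> y' \<and> L x' \<bullet> y' \<le> L x' \<bullet> y)"

text \<open>
  The common payoff of all optimal strategy pairs; for linear \<open>L\<close> on a Euclidean Jordan algebra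
  such pairs exist and their payoff equals the max-min value.
\<close>

definition game_value :: "('a::euclidean_space \<Rightarrow> 'a \<Rightarrow> 'a) \<Rightarrow> 'a \<Rightarrow> ('a \<Rightarrow> 'a) \<Rightarrow> real" where
  "game_value p e L = (THE v. \<exists>x' y'. optimal_pair p e L x' y' \<and> v = L x' \<bullet> y')"

definition completely_mixed ::
    "('a::euclidean_space \<Rightarrow> 'a \<Rightarrow> 'a) \<Rightarrow> 'a \<Rightarrow> ('a \<Rightarrow> 'a) \<Rightarrow> bool" where
  "completely_mixed p e L \<longleftrightarrow> (\<forall>x' y'. optimal_pair p e L x' y' \<longrightarrow>
     x' \<in> interior (symmetric_cone p) \<and> y' \<in> interior (symmetric_cone p))"

end

theory Submission
  imports Defs
begin

text \<open>
  Write \<open>L\<^sup>*\<close> for the adjoint of \<open>L\<close> and call \<open>y\<close> in the symmetric cone \<open>K\<close> with \<open>- L\<^sup>* y \<in> K\<close> a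
  minimizer; when \<open>v(L) = 0\<close>, the optimal strategies are the normalized \<open>x, y \<in> K\<close> with
  \<open>L x \<in> K\<close> and \<open>- L\<^sup>* y \<in> K\<close>. For a primitive idempotent \<open>c\<close> the map \<open>P\<^sub>c\<close> is the orthogonal
  projection onto the line through \<open>c\<close>, so it is self-adjoint and maps \<open>K\<close> into itself.
  
  If \<open>L\<close> is completely mixed and \<open>v(L + P\<^sub>c) \<le> 0\<close>, an optimal \<open>y\<close> of the perturbed game satisfies
  \<open>- L\<^sup>* y - P\<^sub>c y \<in> K\<close>. It is then a minimizer for \<open>L\<close>, hence interior, and pairing with an
  optimal, also interior, \<open>x\<close> for \<open>L\<close> gives \<open>\<langle>x, P\<^sub>c y\<rangle> \<le> - \<langle>L x, y\<rangle> \<le> 0\<close>, although \<open>\<langle>x, P\<^sub>c y\<rangle>\<close> is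
  a positive multiple of \<open>\<langle>x, c\<rangle> \<langle>y, c\<rangle> > 0\<close>.
  
  Conversely, let all the values \<open>v(L + P\<^sub>c)\<close> be positive. A minimizer \<open>y \<noteq> 0\<close> on the boundary of
  \<open>K\<close> would be orthogonal to a primitive idempotent \<open>c\<close>; then \<open>P\<^sub>c y = 0\<close>, so \<open>y\<close> is still a
  minimizer for \<open>L + P\<^sub>c\<close> and forces \<open>v(L + P\<^sub>c) \<le> 0\<close>. So all nonzero minimizers are interior. That the
  optimal \<open>x\<close> are interior too is a fact about arbitrary self-dual cones in the spirit of
  Kaplansky's theorem on matrix games. Let \<open>C\<close> be the cone of all \<open>z\<close>, inside \<open>K\<close> or not, with
  \<open>- L\<^sup>* z \<in> K\<close>, so that \<open>C \<inter> K - {0}\<close> lies in the interior of \<open>K\<close>. Adding multiples of some \<open>z \<in> C\<close>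
  outside \<open>K\<close> to an optimal \<open>y\<close> stays in \<open>C\<close> until the boundary of \<open>K\<close> is reached, which can happen
  only at \<open>0\<close>; so \<open>z\<close> is a multiple of \<open>y\<close>. It follows that \<open>L\<^sup>*\<close> has a one-dimensional kernel and
  that its range is the hyperplane \<open>x\<^sup>\<bottom>\<close>. If \<open>x\<close> were on the boundary, this hyperplane would contain
  some \<open>k \<in> K - {0}\<close>, and the solutions of \<open>- L\<^sup>* z = k\<close>, some of them outside \<open>K\<close>, would lie in \<open>C\<close>
  without being multiples of \<open>y\<close>.

  Three things carry this argument: the spectral decomposition, which yields self-duality of \<open>K\<close>,
  the formula for \<open>P\<^sub>c\<close> and enough primitive idempotents; a minimax theorem for self-dual cones
  (\<open>equilibrium_exists\<close>); and the Kaplansky step (\<open>maximizer_interior_if_minimizers_interior\<close>).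
\<close>

section \<open>Spectral decomposition\<close>

text \<open>
  A maximizer \<open>v\<close> of the Rayleigh quotient on the subspace is an eigenvector: perturbing \<open>v\<close> in the
  direction of the residual \<open>T v - m v\<close> would otherwise increase the quotient to first order.
\<close>

lemma selfadjoint_has_eigenvector:
  fixes T :: "'a::euclidean_space \<Rightarrow> 'a"
  assumes "linear T" and S: "subspace S" "S \<noteq> {0}"
    and inv: "\<And>x. x \<in> S \<Longrightarrow> T x \<in> S"
    and sa: "\<And>x y. x \<in> S \<Longrightarrow> y \<in> S \<Longrightarrow> T x \<bullet> y = x \<bullet> T y"
  obtains v l where "v \<in> S" "v \<noteq> 0" "T v = l *\<^sub>R v"
proof -
  interpret T: linear T by fact
  obtain s where s: "s \<in> S" "s \<noteq> 0"
    using S subspace_0 by blast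
  have "compact (S \<inter> sphere 0 1)"
    using closed_subspace[OF S(1)] by (simp add: closed_Int_compact)
  moreover have "(1 / norm s) *\<^sub>R s \<in> S \<inter> sphere 0 1"
    using s S(1) by (simp add: subspace_scale)
  moreover have "continuous_on (S \<inter> sphere 0 1) (\<lambda>x. T x \<bullet> x)"
    by (intro continuous_intros linear_continuous_on linear_conv_bounded_linear[THEN iffD1] assms)
  ultimately obtain v where v: "v \<in> S" "norm v = 1"
    and max: "\<And>x. x \<in> S \<Longrightarrow> norm x = 1 \<Longrightarrow> T x \<bullet> x \<le> T v \<bullet> v"
    using continuous_attains_sup[of "S \<inter> sphere 0 1" "\<lambda>x. T x \<bullet> x"]
    by (metis (no_types, lifting) IntE IntI empty_iff mem_sphere_0)
  define m where "m = T v \<bullet> v"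
  have bound: "T x \<bullet> x \<le> m * (x \<bullet> x)" if "x \<in> S" for x
  proof (cases "x = 0")
    case False
    have "T ((1 / norm x) *\<^sub>R x) \<bullet> ((1 / norm x) *\<^sub>R x) \<le> m"
      unfolding m_def using False that S(1) by (intro max) (auto simp: subspace_scale)
    then show ?thesis
      using False by (simp add: T.scale field_simps power2_eq_square flip: power2_norm_eq_inner)
  qed (simp add: T.zero)
  define h where "h = T v - m *\<^sub>R v"
  have h: "h \<in> S"
    unfolding h_def using inv v S(1) by (simp add: subspace_diff subspace_scale)
  define q where "q = T h \<bullet> h - m * (h \<bullet> h)"
  have step: "2 * t * (h \<bullet> h) + t\<^sup>2 * q \<le> 0" for t
  proof -
    have "v + t *\<^sub>R h \<in> S" using v h S(1) by (simp add: subspace_add subspace_scale)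
    from bound[OF this]
    have "T v \<bullet> v + t * (T v \<bullet> h + T h \<bullet> v) + t\<^sup>2 * (T h \<bullet> h)
      \<le> m * (v \<bullet> v + 2 * t * (v \<bullet> h) + t\<^sup>2 * (h \<bullet> h))"
      by (simp add: T.add T.scale inner_add_left inner_add_right inner_commute
          power2_eq_square algebra_simps)
    moreover have "T h \<bullet> v = T v \<bullet> h"
      using sa[OF h v(1)] by (simp add: inner_commute)
    moreover have "v \<bullet> v = 1" using v(2) by (simp flip: power2_norm_eq_inner)
    moreover have "T v \<bullet> h = h \<bullet> h + m * (v \<bullet> h)"
      by (simp add: h_def inner_diff_left)
    moreover have "T v \<bullet> v = m" by (simp add: m_def)
    ultimately show ?thesis
      unfolding q_def by (simp add: algebra_simps)
  qed
  have "h \<bullet> h = 0"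
  proof (rule ccontr)
    assume "h \<bullet> h \<noteq> 0"
    then have pos: "h \<bullet> h > 0" by simp
    \<comment> \<open>small enough for the linear term of \<open>step\<close> to dominate its quadratic term\<close>
    define t where "t = (h \<bullet> h) / (1 + \<bar>q\<bar>)"
    have t: "t > 0" using pos by (simp add: t_def)
    have "t * \<bar>q\<bar> \<le> h \<bullet> h" using pos by (simp add: t_def divide_simps mult_left_mono)
    moreover have "- (t * q) \<le> t * \<bar>q\<bar>"
      using t abs_ge_minus_self[of q] by (metis less_imp_le minus_mult_right mult_left_mono)
    moreover have "t * (2 * (h \<bullet> h) + t * q) \<le> 0"
      using step[of t] by (simp add: algebra_simps power2_eq_square)
    ultimately show False using t pos by (simp add: mult_le_0_iff)
  qed
  then show thesis using that[of v m] v(1) norm_eq_zero[of v] v(2) by (simp add: h_def)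
qed

context euclidean_jordan_algebra
begin

lemmas product_simps =
  bilinear_ladd[OF bilinear] bilinear_radd[OF bilinear]
  bilinear_lsub[OF bilinear] bilinear_rsub[OF bilinear]
  bilinear_lmul[OF bilinear] bilinear_rmul[OF bilinear]
  bilinear_lzero[OF bilinear] bilinear_rzero[OF bilinear]

lemma linear_product: "linear (p x)"
  using bilinear by (simp add: bilinear_def)

lemma bounded_bilinear_product: "bounded_bilinear p"
  using bilinear by (simp add: bilinear_conv_bounded_bilinear)

lemma inner_square_unit: "p x x \<bullet> e = x \<bullet> x"
  by (metis commute inner_associative unit)

lemma square_eq_0_iff: "p x x = 0 \<longleftrightarrow> x = 0"
  by (metis inner_eq_zero_iff inner_square_unit inner_zero_left product_simps(7))

text \<open>
  The part of the Jordan identity that is linear in \<open>z\<close>, for the argument \<open>x + z\<close>. It is extracted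
  from the odd part in \<open>z\<close> by taking \<open>x + z\<close> and \<open>x - z\<close> and removing the cubic term, which is the
  identity for \<open>z\<close> itself.
\<close>

lemma linearized_jordan_identity:
  "p z (p (p x x) y) + 2 *\<^sub>R p x (p (p x z) y)
    = 2 *\<^sub>R p (p x z) (p x y) + p (p x x) (p z y)"
proof -
  \<comment> \<open>pairing with \<open>u\<close> turns the combination of vector equations into linear arithmetic\<close>
  have "u \<bullet> (p z (p (p x x) y) + 2 *\<^sub>R p x (p (p x z) y))
      = u \<bullet> (2 *\<^sub>R p (p x z) (p x y) + p (p x x) (p z y))" for u
    using arg_cong[OF jordan_identity[of "x + z" y], of "inner u"]
      arg_cong[OF jordan_identity[of "x - z" y], of "inner u"]
      arg_cong[OF jordan_identity[of z y], of "inner u"]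
    by (simp add: product_simps commute[of z x] inner_add_right inner_diff_right)
  then show ?thesis using vector_eq_ldot by blast
qed

text \<open>
  The power \<open>x\<^sup>n\<^sup>+\<^sup>1\<close>. Leaving out the power \<open>e\<close> keeps all powers of \<open>x\<close> inside every subalgebra
  containing \<open>x\<close>, in particular inside the Peirce space of an idempotent, whose unit is not \<open>e\<close>.
\<close>

definition jpower :: "'a \<Rightarrow> nat \<Rightarrow> 'a" where
  "jpower x n = (p x ^^ n) x"

lemma jpower_simps [simp]: "jpower x 0 = x" "jpower x (Suc n) = p x (jpower x n)"
  by (simp_all add: jpower_def)

lemma square_jpower: "p (p x x) (jpower x n) = jpower x (n + 2)"
proof (induction n)
  case 0
  then show ?case by (simp add: commute)
next
  case (Suc n)
  have "p (p x x) (jpower x (Suc n)) = p x (p (p x x) (jpower x n))"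
    by (simp add: jordan_identity)
  then show ?case using Suc by simp
qed

text \<open>
  The linearized identity read as an operator equation: multiplication by \<open>x\<^sup>n\<^sup>+\<^sup>3\<close> is a polynomial
  in multiplications by lower powers.
\<close>

lemma product_jpower_add2:
  "p (jpower x (n + 2)) z = 2 *\<^sub>R p (jpower x (n + 1)) (p x z)
    + p (p x x) (p (jpower x n) z) - 2 *\<^sub>R p x (p (jpower x n) (p x z))"
proof -
  have "p z (jpower x (n + 2)) + 2 *\<^sub>R p x (p (p x z) (jpower x n))
    = 2 *\<^sub>R p (p x z) (jpower x (n + 1)) + p (p x x) (p z (jpower x n))"
    using linearized_jordan_identity[of z x "jpower x n"] by (simp only: square_jpower) simp
  then show ?thesis
    by (simp only: commute[of z] commute[of "p x z"] eq_diff_eq)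
qed

text \<open>
  By the recursion \<open>product_jpower_add2\<close>, multiplication by any power of \<open>x\<close> lies in the algebra
  generated by multiplication by \<open>x\<close> and by \<open>x\<^sup>2\<close>, and these two commute by the Jordan identity.
\<close>

lemma jpower_operators_commute:
  "(\<forall>y. p x (p (jpower x n) y) = p (jpower x n) (p x y)) \<and>
   (\<forall>y. p (p x x) (p (jpower x n) y) = p (jpower x n) (p (p x x) y))"
proof (induction n rule: less_induct)
  case (less n)
  consider "n = 0" | "n = 1" | k where "n = k + 2"
    by (metis add_2_eq_Suc' not0_implies_Suc One_nat_def)
  then show ?case
  proof cases
    case 3
    note IH = less[of k] less[of "k + 1"]
    show ?thesis
      unfolding 3 product_jpower_add2
      using IH 3 by (simp add: product_simps jordan_identity)
  qed (simp_all add: jordan_identity)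
qed

lemma jpower_mult: "p (jpower x m) (jpower x n) = jpower x (m + n + 1)"
proof (induction n)
  case 0
  then show ?case by (simp add: commute)
next
  case (Suc n)
  have "p (jpower x m) (jpower x (Suc n)) = p x (p (jpower x m) (jpower x n))"
    using jpower_operators_commute[of x m] by simp
  then show ?case using Suc by simp
qed

text \<open>
  The induction for the spectral decomposition passes to annihilators of idempotents, so the
  subalgebras need not contain \<open>e\<close>.
\<close>

definition associative_subalgebra :: "'a set \<Rightarrow> bool" where
  "associative_subalgebra B \<longleftrightarrow> subspace B \<and> (\<forall>a\<in>B. \<forall>b\<in>B. p a b \<in> B) \<and>
     (\<forall>a\<in>B. \<forall>b\<in>B. \<forall>c\<in>B. p (p a b) c = p a (p b c))"

lemma associative_subalgebra_span_jpower:
  "associative_subalgebra (span (range (jpower x)))"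
proof -
  let ?B = "span (range (jpower x))"
  have closed1: "p a (jpower x n) \<in> ?B" if "a \<in> ?B" for a n
    using that
  proof (induction rule: span_induct)
    case base
    then show ?case
      by (auto simp: subspace_def product_simps span_zero span_add span_scale)
  next
    case (step a)
    then show ?case by (auto simp: jpower_mult simp del: jpower_simps intro!: span_base)
  qed
  have closed: "p a b \<in> ?B" if "a \<in> ?B" "b \<in> ?B" for a b
    using that(2)
  proof (induction rule: span_induct)
    case base
    then show ?case
      by (auto simp: subspace_def product_simps span_zero span_add span_scale)
  next
    case (step b)
    then show ?case using closed1[OF that(1)] by auto
  qed
  have assoc1: "p (p (jpower x l) (jpower x m)) c = p (jpower x l) (p (jpower x m) c)"
    if "c \<in> ?B" for l m c
    using that
  proof (induction rule: span_induct)
    case base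
    then show ?case by (auto simp: subspace_def product_simps)
  next
    case (step c)
    then show ?case by (auto simp: jpower_mult add_ac simp del: jpower_simps)
  qed
  have assoc2: "p (p (jpower x l) b) c = p (jpower x l) (p b c)"
    if "b \<in> ?B" "c \<in> ?B" for l b c
    using that(1)
  proof (induction rule: span_induct)
    case base
    then show ?case by (auto simp: subspace_def product_simps)
  next
    case (step b)
    then show ?case using assoc1[OF that(2)] by auto
  qed
  have "p (p a b) c = p a (p b c)" if "a \<in> ?B" "b \<in> ?B" "c \<in> ?B" for a b c
    using that(1)
  proof (induction rule: span_induct)
    case base
    then show ?case by (auto simp: subspace_def product_simps)
  next
    case (step a)
    then show ?case using assoc2[OF that(2,3)] by auto
  qed
  with closed show ?thesis
    unfolding associative_subalgebra_def by blast
qed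

text \<open>
  On an ideal \<open>I\<close> of least positive dimension every \<open>b \<in> B\<close> acts as a scalar, because the
  eigenspaces of \<open>b\<close> in \<open>I\<close> are again ideals. A nonzero \<open>v \<in> I\<close> therefore satisfies \<open>v\<^sup>2 = k v\<close> with
  \<open>k \<noteq> 0\<close>, and \<open>v / k\<close> is the idempotent.
\<close>

lemma associative_subalgebra_minimal_idempotent:
  assumes B: "associative_subalgebra B" and "B \<noteq> {0}"
  obtains c where "c \<in> B" "idempotent p c" "c \<noteq> 0" "\<And>b. b \<in> B \<Longrightarrow> \<exists>l. p b c = l *\<^sub>R c"
proof -
  have sB: "subspace B" and cB: "\<And>a b. a \<in> B \<Longrightarrow> b \<in> B \<Longrightarrow> p a b \<in> B"
    and aB: "\<And>a b c. a \<in> B \<Longrightarrow> b \<in> B \<Longrightarrow> c \<in> B \<Longrightarrow> p (p a b) c = p a (p b c)"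
    using B by (auto simp: associative_subalgebra_def)
  define ideal where "ideal I \<longleftrightarrow> subspace I \<and> I \<subseteq> B \<and> I \<noteq> {0} \<and> (\<forall>b\<in>B. \<forall>i\<in>I. p b i \<in> I)" for I
  have "ideal B" using sB cB assms(2) by (auto simp: ideal_def)
  then obtain I where I: "ideal I" and min: "\<And>J. ideal J \<Longrightarrow> dim I \<le> dim J"
    using ex_has_least_nat[of ideal B dim] by auto
  have sI: "subspace I" and IB: "I \<subseteq> B" and I0: "I \<noteq> {0}"
    and iI: "\<And>b i. b \<in> B \<Longrightarrow> i \<in> I \<Longrightarrow> p b i \<in> I"
    using I by (auto simp: ideal_def)
  have scalar: "\<exists>l. \<forall>i\<in>I. p b i = l *\<^sub>R i" if b: "b \<in> B" for b
  proof -
    obtain v l where v: "v \<in> I" "v \<noteq> 0" "p b v = l *\<^sub>R v"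
      using selfadjoint_has_eigenvector[OF linear_product sI I0, of b] iI[OF b] inner_associative
      by (metis commute)
    define J where "J = {i \<in> I. p b i = l *\<^sub>R i}"
    have "subspace J"
      using sI by (auto simp: J_def subspace_def product_simps scaleR_add_right)
    moreover have "p b' i \<in> J" if "b' \<in> B" "i \<in> J" for b' i
    proof -
      have i: "i \<in> I" "i \<in> B" "p b i = l *\<^sub>R i" using that IB by (auto simp: J_def)
      have "p b (p b' i) = p (p b b') i" using aB[OF b that(1) i(2)] by simp
      also have "\<dots> = p b' (p b i)" using aB[OF that(1) b i(2)] by (simp add: commute)
      finally show ?thesis using i iI[OF that(1) i(1)] by (simp add: J_def product_simps)
    qed
    ultimately have "ideal J"
      using v IB by (auto simp: ideal_def J_def)
    then have "J = I"
      using min[of J] sI \<open>subspace J\<close> by (intro subspace_dim_equal) (auto simp: J_def)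
    then show ?thesis by (auto simp: J_def)
  qed
  obtain v where v: "v \<in> I" "v \<noteq> 0" using I0 sI subspace_0 by blast
  obtain k where k: "p v v = k *\<^sub>R v" using scalar[of v] v IB by blast
  have k0: "k \<noteq> 0" using k v square_eq_0_iff[of v] by auto
  show thesis
  proof (rule that[of "(1 / k) *\<^sub>R v"])
    show "(1 / k) *\<^sub>R v \<in> B" using v IB sB by (auto simp: subspace_scale)
    show "idempotent p ((1 / k) *\<^sub>R v)" using k k0 by (simp add: idempotent_def product_simps)
    show "(1 / k) *\<^sub>R v \<noteq> 0" using k0 v by simp
    show "\<exists>l. p b ((1 / k) *\<^sub>R v) = l *\<^sub>R ((1 / k) *\<^sub>R v)" if "b \<in> B" for b
      using scalar[OF that] v by (auto simp: product_simps)
  qed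
qed

definition spectral_decomposition :: "'a set \<Rightarrow> ('a \<Rightarrow> real) \<Rightarrow> 'a \<Rightarrow> bool" where
  "spectral_decomposition F r x \<longleftrightarrow> finite F \<and> (\<forall>c\<in>F. idempotent p c \<and> c \<noteq> 0) \<and>
     (\<forall>c\<in>F. \<forall>d\<in>F. c \<noteq> d \<longrightarrow> p c d = 0) \<and> x = (\<Sum>c\<in>F. r c *\<^sub>R c)"

text \<open>
  Induction on the dimension: split off the component of \<open>x\<close> along a minimal idempotent \<open>c\<close>; the
  rest lies in the annihilator of \<open>c\<close>, which is a smaller associative subalgebra.
\<close>

lemma associative_subalgebra_spectral_decomposition:
  assumes "associative_subalgebra B" "x \<in> B"
  shows "\<exists>F r. F \<subseteq> B \<and> spectral_decomposition F r x"
  using assms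
proof (induction "dim B" arbitrary: B x rule: less_induct)
  case less
  show ?case
  proof (cases "B = {0}")
    case True
    then have "{} \<subseteq> B \<and> spectral_decomposition {} (\<lambda>_. 0) x"
      using less.prems by (simp add: spectral_decomposition_def)
    then show ?thesis by blast
  next
    case False
    obtain c where c: "c \<in> B" "idempotent p c" "c \<noteq> 0" "\<And>b. b \<in> B \<Longrightarrow> \<exists>l. p b c = l *\<^sub>R c"
      using associative_subalgebra_minimal_idempotent[OF less.prems(1) False] by blast
    have cc: "p c c = c" using c by (simp add: idempotent_def)
    obtain l where l: "p x c = l *\<^sub>R c" using c(4) less.prems by blast
    have sB: "subspace B" and cB: "\<And>a b. a \<in> B \<Longrightarrow> b \<in> B \<Longrightarrow> p a b \<in> B"
      and aB: "\<And>a b c. a \<in> B \<Longrightarrow> b \<in> B \<Longrightarrow> c \<in> B \<Longrightarrow> p (p a b) c = p a (p b c)"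
      using less.prems(1) by (auto simp: associative_subalgebra_def)
    define B' where "B' = {b \<in> B. p b c = 0}"
    have sB': "subspace B'"
      using sB by (auto simp: B'_def subspace_def product_simps)
    have "associative_subalgebra B'"
      unfolding associative_subalgebra_def
      using sB' cB aB c(1) by (auto simp: B'_def product_simps)
    moreover have "dim B' < dim B"
    proof (rule dim_psubset)
      have "c \<notin> B'" using cc c by (simp add: B'_def)
      then show "span B' \<subset> span B"
        using c(1) sB sB' by (auto simp: span_eq_iff[THEN iffD2] B'_def)
    qed
    moreover have "x - l *\<^sub>R c \<in> B'"
      using less.prems c sB l cc by (simp add: B'_def subspace_diff subspace_scale product_simps)
    ultimately obtain F r where F: "F \<subseteq> B'" "spectral_decomposition F r (x - l *\<^sub>R c)"
      using less.hyps by blast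
    have cF: "c \<notin> F" using F(1) cc c by (auto simp: B'_def)
    have orth: "p d c = 0" "p c d = 0" if "d \<in> F" for d
      using that F(1) commute by (auto simp: B'_def)
    have "x = l *\<^sub>R c + (\<Sum>d\<in>F. r d *\<^sub>R d)"
      using F(2) by (simp add: spectral_decomposition_def algebra_simps)
    also have "\<dots> = (\<Sum>d\<in>insert c F. (r(c := l)) d *\<^sub>R d)"
    proof -
      have "(\<Sum>d\<in>F. (r(c := l)) d *\<^sub>R d) = (\<Sum>d\<in>F. r d *\<^sub>R d)"
        using cF by (intro sum.cong) auto
      then show ?thesis using F(2) cF by (simp add: spectral_decomposition_def)
    qed
    finally have "spectral_decomposition (insert c F) (r(c := l)) x"
      using F(2) c orth by (auto simp: spectral_decomposition_def)
    moreover have "insert c F \<subseteq> B" using F(1) c(1) by (auto simp: B'_def)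
    ultimately show ?thesis by blast
  qed
qed

lemma spectral_decomposition_in_span_jpower:
  obtains F r where "F \<subseteq> span (range (jpower x))" "spectral_decomposition F r x"
proof -
  have "x = jpower x 0" by simp
  then have "x \<in> span (range (jpower x))" by (metis rangeI span_base)
  with associative_subalgebra_spectral_decomposition[OF associative_subalgebra_span_jpower]
  show thesis using that by blast
qed

section \<open>Idempotents and the symmetric cone\<close>

text \<open>
  The equation \<open>2T\<^sup>3 - 3T\<^sup>2 + T = 0\<close> for multiplication \<open>T\<close> by an idempotent, which restricts its
  eigenvalues to \<open>0\<close>, \<open>1/2\<close> and \<open>1\<close>.
\<close>

lemma peirce_identity:
  assumes "p c c = c"
  shows "2 *\<^sub>R p c (p c (p c x)) = 3 *\<^sub>R p c (p c x) - p c x"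
proof -
  have "p x c + 2 *\<^sub>R p c (p (p c x) c) = 2 *\<^sub>R p (p c x) c + p c (p x c)"
    using linearized_jordan_identity[of x c c] assms by simp
  then have "p c x + 2 *\<^sub>R p c (p c (p c x)) = 2 *\<^sub>R p c (p c x) + p c (p c x)"
    by (simp add: commute[of _ c])
  moreover have "3 *\<^sub>R p c (p c x) = 2 *\<^sub>R p c (p c x) + p c (p c x)"
    using scaleR_add_left[of 2 1 "p c (p c x)"] by simp
  ultimately show ?thesis by (simp add: eq_diff_eq add.commute)
qed

text \<open>
  Multiplication \<open>T\<close> by an idempotent is positive semidefinite. With
  \<open>u = T x\<close> and \<open>w = T u\<close>, the Peirce identity gives \<open>4 \<parallel>u - w\<parallel>\<^sup>2 = \<langle>u, x\<rangle> - \<parallel>u\<parallel>\<^sup>2\<close>.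
\<close>

lemma inner_product_idempotent_nonneg:
  assumes "p c c = c"
  shows "0 \<le> p c x \<bullet> x"
proof -
  define u where "u = p c x"
  define w where "w = p c u"
  have cw: "p c w = (1/2) *\<^sub>R (3 *\<^sub>R w - u)"
    by (simp add: u_def w_def flip: peirce_identity[OF assms])
  have sym: "p c a \<bullet> b = a \<bullet> p c b" for a b using inner_associative by simp
  have 1: "w \<bullet> x = u \<bullet> u" unfolding w_def sym u_def[symmetric] ..
  have 2: "2 * (u \<bullet> w) = 3 * (u \<bullet> u) - u \<bullet> x"
  proof -
    have "u \<bullet> w = x \<bullet> p c w" unfolding u_def sym ..
    then show ?thesis using 1 by (simp add: cw inner_diff_right inner_commute)
  qed
  have 3: "2 * (w \<bullet> w) = 3 * (u \<bullet> w) - u \<bullet> u"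
  proof -
    have "w \<bullet> w = u \<bullet> p c w" by (subst (1) w_def) (rule sym)
    then show ?thesis by (simp add: cw inner_diff_right)
  qed
  have "0 \<le> (u - w) \<bullet> (u - w)" by simp
  then have "0 \<le> u \<bullet> u - 2 * (u \<bullet> w) + w \<bullet> w"
    by (simp add: inner_diff_left inner_diff_right inner_commute)
  then have "0 \<le> u \<bullet> x" using 2 3 inner_ge_zero[of u] by linarith
  then show ?thesis by (simp add: u_def)
qed

lemma inner_orthogonal_idempotents:
  assumes "p c c = c" "p c d = 0"
  shows "c \<bullet> d = 0"
  by (metis assms inner_associative inner_zero_right)

lemma spectral_decomposition_square:
  assumes "spectral_decomposition F r x"
  shows "p x x = (\<Sum>c\<in>F. (r c)\<^sup>2 *\<^sub>R c)"
proof -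
  interpret B: bounded_bilinear p by (rule bounded_bilinear_product)
  have "p x x = (\<Sum>c\<in>F. \<Sum>d\<in>F. (r c * r d) *\<^sub>R p c d)"
    using assms unfolding spectral_decomposition_def
    by (simp add: B.sum_left B.sum_right product_simps commute mult.commute)
  also have "\<dots> = (\<Sum>c\<in>F. \<Sum>d\<in>F. if d = c then (r c)\<^sup>2 *\<^sub>R c else 0)"
    using assms by (intro sum.cong refl)
      (auto simp: spectral_decomposition_def idempotent_def power2_eq_square)
  finally show ?thesis
    using assms by (simp add: spectral_decomposition_def)
qed

text \<open>
  Squares pair nonnegatively because \<open>b\<^sup>2\<close> is a nonnegative combination of idempotents \<open>c\<close> and
  \<open>\<langle>a\<^sup>2, c\<rangle> = \<langle>c \<circ> a, a\<rangle> \<ge> 0\<close>. Conversely, pairing \<open>x\<close> with the idempotents of its own spectral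
  decomposition shows that its eigenvalues are nonnegative, so that \<open>x\<close> has a square root.
\<close>

lemma symmetric_cone_self_dual:
  "x \<in> symmetric_cone p \<longleftrightarrow> (\<forall>y\<in>symmetric_cone p. 0 \<le> x \<bullet> y)"
proof
  assume "x \<in> symmetric_cone p"
  then obtain a where a: "x = p a a" by (auto simp: symmetric_cone_def)
  show "\<forall>y\<in>symmetric_cone p. 0 \<le> x \<bullet> y"
  proof
    fix y assume "y \<in> symmetric_cone p"
    then obtain b where b: "y = p b b" by (auto simp: symmetric_cone_def)
    obtain F r where F: "spectral_decomposition F r b"
      using spectral_decomposition_in_span_jpower by blast
    have "0 \<le> p a a \<bullet> c" if "c \<in> F" for c
    proof -
      have "p a a \<bullet> c = p c a \<bullet> a"
        by (metis commute inner_associative inner_commute)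
      then show ?thesis
        using inner_product_idempotent_nonneg[of c a] F that
        by (simp add: spectral_decomposition_def idempotent_def)
    qed
    then show "0 \<le> x \<bullet> y"
      unfolding a b spectral_decomposition_square[OF F]
      by (auto simp: inner_sum_right intro!: sum_nonneg)
  qed
next
  assume dual: "\<forall>y\<in>symmetric_cone p. 0 \<le> x \<bullet> y"
  obtain F r where F: "spectral_decomposition F r x"
    using spectral_decomposition_in_span_jpower by blast
  have r: "0 \<le> r c" if "c \<in> F" for c
  proof -
    have c: "p c c = c" "c \<noteq> 0"
      using F that by (auto simp: spectral_decomposition_def idempotent_def)
    have "c \<in> symmetric_cone p" using c by (metis (mono_tags) symmetric_cone_def mem_Collect_eq)
    then have "0 \<le> x \<bullet> c" using dual by blast
    also have "x \<bullet> c = (\<Sum>d\<in>F. r d * (d \<bullet> c))"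
      using F by (simp add: spectral_decomposition_def inner_sum_left)
    also have "\<dots> = (\<Sum>d\<in>F. if d = c then r c * (c \<bullet> c) else 0)"
      using F that
      by (intro sum.cong refl)
        (auto simp: spectral_decomposition_def idempotent_def inner_orthogonal_idempotents)
    also have "\<dots> = r c * (c \<bullet> c)" using F that by (simp add: spectral_decomposition_def)
    finally show ?thesis using c(2) inner_gt_zero_iff[of c] by (metis zero_le_mult_iff not_le)
  qed
  have "spectral_decomposition F (\<lambda>c. sqrt (r c)) (\<Sum>c\<in>F. sqrt (r c) *\<^sub>R c)"
    using F by (simp add: spectral_decomposition_def)
  from spectral_decomposition_square[OF this]
  have "p (\<Sum>c\<in>F. sqrt (r c) *\<^sub>R c) (\<Sum>c\<in>F. sqrt (r c) *\<^sub>R c) = x"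
    using F r by (simp add: spectral_decomposition_def)
  then show "x \<in> symmetric_cone p" by (auto simp: symmetric_cone_def)
qed

lemma idempotent_in_symmetric_cone: "idempotent p c \<Longrightarrow> c \<in> symmetric_cone p"
  unfolding symmetric_cone_def idempotent_def by (metis (mono_tags) mem_Collect_eq)

text \<open>
  All powers of \<open>x\<close> stay in the Peirce space of elements fixed by \<open>c\<close>, hence so do the idempotents
  \<open>d\<close> of its spectral decomposition. Then \<open>c = d + (c - d)\<close> is a sum of idempotents, and primitivity
  of \<open>c\<close> leaves \<open>d = c\<close> only.
\<close>

lemma peirce_one_space_primitive:
  assumes "primitive_idempotent p c" and x: "p c x = x"
  shows "\<exists>l. x = l *\<^sub>R c"
proof -
  have c: "p c c = c" "c \<noteq> 0"
    and prim: "\<And>a b. \<lbrakk>p a a = a; a \<noteq> 0; p b b = b; b \<noteq> 0\<rbrakk> \<Longrightarrow> c \<noteq> a + b"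
    using assms(1) unfolding primitive_idempotent_def idempotent_def by blast+
  have comm: "p c (p x y) = p x (p c y)" for y
  proof -
    have "p x (p c y) + 2 *\<^sub>R p c (p x y) = 2 *\<^sub>R p x (p c y) + p c (p x y)"
      using linearized_jordan_identity[of x c y] c x by simp
    then show ?thesis by (simp add: scaleR_2)
  qed
  have "p c (jpower x n) = jpower x n" for n
    by (induction n) (simp_all add: x comm)
  then have unit_B: "p c b = b" if "b \<in> span (range (jpower x))" for b
    using that[THEN span_induct, of "\<lambda>b. p c b = b"]
    by (auto simp: subspace_def product_simps)
  obtain F r where F: "F \<subseteq> span (range (jpower x))" "spectral_decomposition F r x"
    using spectral_decomposition_in_span_jpower by blast
  have "d = c" if "d \<in> F" for d
  proof (rule ccontr)
    assume "d \<noteq> c"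
    have d: "p d d = d" "d \<noteq> 0"
      using F(2) that by (auto simp: spectral_decomposition_def idempotent_def)
    have cd: "p c d = d" "p d c = d"
      using unit_B[of d] F(1) that commute[of d c] by auto
    have "p (c - d) (c - d) = c - d" using c d cd by (simp add: product_simps)
    then show False using prim[of d "c - d"] d \<open>d \<noteq> c\<close> by simp
  qed
  then have "F = {} \<or> F = {c}" by blast
  then show ?thesis
    using F(2) by (auto simp: spectral_decomposition_def intro: exI[of _ 0])
qed

text \<open>
  By the Peirce identity \<open>P\<^sub>c\<close> takes values in the Peirce space fixed by \<open>c\<close>, which is the line through
  \<open>c\<close>; the coefficient follows by pairing with \<open>c\<close>. The right-hand side is the orthogonal
  projection onto this line.
\<close>

lemma quad_rep_primitive:
  assumes "primitive_idempotent p c"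
  shows "quad_rep p c x = ((x \<bullet> c) / (c \<bullet> c)) *\<^sub>R c"
proof -
  have c: "p c c = c" "c \<noteq> 0"
    using assms by (auto simp: primitive_idempotent_def idempotent_def)
  have "p c (quad_rep p c x) = quad_rep p c x"
  proof -
    have "3 *\<^sub>R y - p c x - y = 2 *\<^sub>R y - p c x" for y
      using scaleR_add_left[of 2 1 y] by simp
    then show ?thesis
      by (simp add: quad_rep_def c product_simps peirce_identity)
  qed
  then obtain l where l: "quad_rep p c x = l *\<^sub>R c"
    using peirce_one_space_primitive[OF assms] by blast
  have "p c y \<bullet> c = y \<bullet> c" for y using inner_associative[of c y c] c by simp
  then have "quad_rep p c x \<bullet> c = x \<bullet> c"
    by (simp add: quad_rep_def c inner_diff_left)
  then show ?thesis using l c(2) by (simp add: field_simps)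
qed

text \<open>
  Some idempotent of the spectral decomposition of a square root of \<open>k\<close> is orthogonal to \<open>y\<close>. Among
  all nonzero idempotents orthogonal to \<open>y\<close> one of least inner product with \<open>e\<close> is primitive: the
  summands of a nontrivial decomposition would again be orthogonal to \<open>y\<close>, with smaller inner products. A minimum exists since
  these idempotents form a compact set.
\<close>

lemma primitive_idempotent_orthogonal:
  assumes y: "y \<in> symmetric_cone p" and k: "k \<in> symmetric_cone p" "k \<noteq> 0" "y \<bullet> k = 0"
  obtains c where "primitive_idempotent p c" "y \<bullet> c = 0"
proof -
  define S where "S = {c. p c c = c \<and> c \<noteq> 0 \<and> y \<bullet> c = 0}"
  have pos: "0 \<le> y \<bullet> c" if "p c c = c" for c
    using symmetric_cone_self_dual[THEN iffD1, OF y] idempotent_in_symmetric_cone[of c] that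
    unfolding idempotent_def by blast
  obtain a where a: "k = p a a" using k by (auto simp: symmetric_cone_def)
  obtain F r where F: "spectral_decomposition F r a"
    using spectral_decomposition_in_span_jpower by blast
  have k_eq: "k = (\<Sum>c\<in>F. (r c)\<^sup>2 *\<^sub>R c)"
    using spectral_decomposition_square[OF F] a by simp
  have nonneg: "0 \<le> (r c)\<^sup>2 * (y \<bullet> c)" if "c \<in> F" for c
    using F that pos by (simp add: spectral_decomposition_def idempotent_def)
  have "(\<Sum>c\<in>F. (r c)\<^sup>2 * (y \<bullet> c)) = 0"
    using k(3) by (simp add: k_eq inner_sum_right)
  then have zero: "(r c)\<^sup>2 * (y \<bullet> c) = 0" if "c \<in> F" for c
    using sum_nonneg_eq_0_iff[of F "\<lambda>c. (r c)\<^sup>2 * (y \<bullet> c)"] nonneg F that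
    by (auto simp: spectral_decomposition_def)
  obtain c where "c \<in> F" "r c \<noteq> 0"
    using k(2) unfolding k_eq by (metis (no_types, lifting) sum.neutral scaleR_zero_left zero_power2)
  then have "c \<in> S"
    using zero[of c] F by (auto simp: S_def spectral_decomposition_def idempotent_def)
  interpret B: bounded_bilinear p by (rule bounded_bilinear_product)
  obtain M where M: "M > 0" "\<And>a b. norm (p a b) \<le> norm a * norm b * M"
    using B.pos_bounded by blast
  \<comment> \<open>nonzero idempotents stay away from \<open>0\<close>, so excluding \<open>0\<close> is a closed condition\<close>
  have low: "1 / M \<le> norm c" if "p c c = c" "c \<noteq> 0" for c
    using M(2)[of c c] that M(1) by (simp add: field_simps)
  have "S = {c. p c c = c} \<inter> {c. y \<bullet> c = 0} \<inter> {c. 1 / M \<le> norm c}"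
    using low M(1) by (auto simp: S_def) 
  moreover have "closed {c. p c c = c}" "closed {c. y \<bullet> c = 0}" "closed {c. 1 / M \<le> norm c}"
    by (intro closed_Collect_eq closed_Collect_le continuous_intros B.continuous_on)+
  ultimately have "closed S" by auto
  moreover have "bounded S"
  proof -
    have "norm c \<le> norm e" if "c \<in> S" for c
    proof -
      have c: "p c c = c" "c \<noteq> 0" using that by (auto simp: S_def)
      have "norm c * norm c = c \<bullet> e"
        using inner_square_unit[of c] c
        by (simp add: power2_eq_square flip: power2_norm_eq_inner)
      also have "\<dots> \<le> norm c * norm e" by (rule norm_cauchy_schwarz)
      finally show ?thesis using c(2) by simp
    qed
    then show ?thesis by (auto simp: bounded_iff)
  qed
  ultimately have "compact S" by (simp add: compact_eq_bounded_closed)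
  then obtain c where c: "c \<in> S" and min: "\<And>d. d \<in> S \<Longrightarrow> c \<bullet> e \<le> d \<bullet> e"
    using continuous_attains_inf[of S "\<lambda>c. c \<bullet> e"] \<open>c \<in> S\<close>
    using continuous_on_inner[OF continuous_on_id continuous_on_const] by blast
  have "primitive_idempotent p c"
    unfolding primitive_idempotent_def idempotent_def
  proof (intro conjI notI)
    show "p c c = c" "c = 0 \<Longrightarrow> False" using c by (auto simp: S_def)
    assume "\<exists>a b. p a a = a \<and> a \<noteq> 0 \<and> p b b = b \<and> b \<noteq> 0 \<and> c = a + b"
    then obtain a b where ab: "p a a = a" "a \<noteq> 0" "p b b = b" "b \<noteq> 0" "c = a + b" by blast
    have "y \<bullet> a = 0"
      using pos[OF ab(1)] pos[OF ab(3)] c ab(5) by (simp add: S_def inner_add_right)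
    then have "a \<in> S" using ab by (simp add: S_def)
    from min[OF this] have "b \<bullet> e \<le> 0" using ab(5) by (simp add: inner_add_left)
    moreover have "b \<bullet> e = b \<bullet> b" using inner_square_unit[of b] ab(3) by simp
    moreover have "0 < b \<bullet> b" using ab(4) by simp
    ultimately show False by linarith
  qed
  then show thesis using that c by (auto simp: S_def)
qed

end

section \<open>Linear games on a self-dual cone\<close>

locale self_dual_cone =
  fixes K :: "'a::euclidean_space set" and e :: 'a
  assumes self_dual: "x \<in> K \<longleftrightarrow> (\<forall>y\<in>K. 0 \<le> x \<bullet> y)"
    and unit_in_cone: "e \<in> K"
    and inner_unit_pos: "k \<in> K \<Longrightarrow> k \<noteq> 0 \<Longrightarrow> 0 < k \<bullet> e"
begin

lemma inner_nonneg: "x \<in> K \<Longrightarrow> y \<in> K \<Longrightarrow> 0 \<le> x \<bullet> y"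
  using self_dual by blast

lemma cone_memI: "(\<And>y. y \<in> K \<Longrightarrow> 0 \<le> x \<bullet> y) \<Longrightarrow> x \<in> K"
  using self_dual by blast

lemma zero_in_cone: "0 \<in> K"
  by (rule cone_memI) simp

lemma cone_add: "x \<in> K \<Longrightarrow> y \<in> K \<Longrightarrow> x + y \<in> K"
  by (rule cone_memI) (simp add: inner_add_left inner_nonneg)

lemma cone_scale: "x \<in> K \<Longrightarrow> 0 \<le> r \<Longrightarrow> r *\<^sub>R x \<in> K"
  by (rule cone_memI) (simp add: inner_nonneg)

lemma convex_cone: "convex K"
  unfolding convex_def by (auto intro: cone_add cone_scale)

lemma closed_cone: "closed K"
proof -
  have "K = (\<Inter>y\<in>K. {x. 0 \<le> x \<bullet> y})"
    using self_dual by blast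
  moreover have "closed (\<Inter>y\<in>K. {x. 0 \<le> x \<bullet> y})"
    by (intro closed_INT ballI closed_Collect_le continuous_intros)
  ultimately show ?thesis by simp
qed

lemma pointed:
  assumes "x \<in> K" "- x \<in> K"
  shows "x = 0"
proof -
  have "0 \<le> x \<bullet> - x" using assms by (rule inner_nonneg)
  then show ?thesis using inner_gt_zero_iff[of x] by fastforce
qed

lemma unit_nonzero: "e \<noteq> 0"
proof
  assume "e = 0"
  then have "K \<subseteq> {0}" using inner_unit_pos by force
  then have "x \<in> K" for x by (intro cone_memI) auto
  with \<open>K \<subseteq> {0}\<close> nonempty_Basis[where 'a = 'a] nonzero_Basis show False by blast
qed

text \<open>
  A functional that is positive on \<open>K - {0}\<close> attains a positive minimum on the compact set of unit
  vectors of \<open>K\<close>. This gives both compactness of the set of strategies and the description of the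
  interior of \<open>K\<close>.
\<close>

lemma positive_functional_coercive:
  assumes pos: "\<And>k. k \<in> K \<Longrightarrow> k \<noteq> 0 \<Longrightarrow> 0 < x \<bullet> k"
  obtains m where "m > 0" "\<And>k. k \<in> K \<Longrightarrow> m * norm k \<le> x \<bullet> k"
proof -
  have "compact (K \<inter> sphere 0 1)"
    using closed_cone by (simp add: closed_Int_compact)
  moreover have "(1 / norm e) *\<^sub>R e \<in> K \<inter> sphere 0 1"
    using unit_nonzero unit_in_cone by (simp add: cone_scale)
  moreover have "continuous_on (K \<inter> sphere 0 1) (\<lambda>k. x \<bullet> k)"
    by (intro continuous_intros)
  ultimately obtain k0 where k0: "k0 \<in> K" "norm k0 = 1"
    and min: "\<And>k. k \<in> K \<Longrightarrow> norm k = 1 \<Longrightarrow> x \<bullet> k0 \<le> x \<bullet> k"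
    using continuous_attains_inf[of "K \<inter> sphere 0 1" "\<lambda>k. x \<bullet> k"]
    by (metis (no_types, lifting) IntE IntI empty_iff mem_sphere_0)
  show thesis
  proof (rule that[of "x \<bullet> k0"])
    show "0 < x \<bullet> k0" using pos[OF k0(1)] k0(2) by force
    show "x \<bullet> k0 * norm k \<le> x \<bullet> k" if "k \<in> K" for k
    proof (cases "k = 0")
      case False
      then show ?thesis
        using min[of "(1 / norm k) *\<^sub>R k"] that
        by (simp add: cone_scale field_simps)
    qed simp
  qed
qed

lemma mem_interior_cone_iff:
  "x \<in> interior K \<longleftrightarrow> (\<forall>k\<in>K. k \<noteq> 0 \<longrightarrow> 0 < x \<bullet> k)"
proof
  assume "x \<in> interior K"
  then obtain d where d: "d > 0" "cball x d \<subseteq> K"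
    by (meson mem_interior_cball)
  show "\<forall>k\<in>K. k \<noteq> 0 \<longrightarrow> 0 < x \<bullet> k"
  proof (intro ballI impI)
    fix k assume k: "k \<in> K" "k \<noteq> 0"
    have "x - (d / norm k) *\<^sub>R k \<in> cball x d" using d k by (simp add: dist_norm)
    then have "0 \<le> (x - (d / norm k) *\<^sub>R k) \<bullet> k" using d k inner_nonneg by blast
    moreover have "0 < (d / norm k) * (k \<bullet> k)" using d k by simp
    ultimately show "0 < x \<bullet> k" by (simp add: inner_diff_left)
  qed
next
  assume pos: "\<forall>k\<in>K. k \<noteq> 0 \<longrightarrow> 0 < x \<bullet> k"
  obtain m where m: "m > 0" "\<And>k. k \<in> K \<Longrightarrow> m * norm k \<le> x \<bullet> k"
    using positive_functional_coercive[of x] pos by blast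
  have "cball x m \<subseteq> K"
  proof
    fix z assume "z \<in> cball x m"
    then have z: "norm (x - z) \<le> m" by (simp add: dist_norm)
    show "z \<in> K"
    proof (rule cone_memI)
      fix k assume k: "k \<in> K"
      have "(x - z) \<bullet> k \<le> norm (x - z) * norm k" by (rule norm_cauchy_schwarz)
      also have "\<dots> \<le> m * norm k" using z by (simp add: mult_right_mono)
      also have "\<dots> \<le> x \<bullet> k" using m k by blast
      finally show "0 \<le> z \<bullet> k" by (simp add: inner_diff_left)
    qed
  qed
  then show "x \<in> interior K" using m(1) by (meson mem_interior_cball)
qed

lemma not_interior_cone_orthogonal:
  assumes "x \<in> K" "x \<notin> interior K"
  obtains k where "k \<in> K" "k \<noteq> 0" "x \<bullet> k = 0"
  using assms inner_nonneg[of x] by (force simp: mem_interior_cone_iff)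

text \<open>
  The ray starts inside the closed cone and eventually leaves it, so it meets the frontier.
\<close>

lemma ray_exits_cone:
  assumes y: "y \<in> interior K" and z: "z \<notin> K"
  obtains t where "t > 0" "y + t *\<^sub>R z \<in> K" "y + t *\<^sub>R z \<notin> interior K"
proof -
  obtain k where k: "k \<in> K" "z \<bullet> k < 0"
    using z self_dual[of z] by (auto simp: not_le)
  define s where "s = (y \<bullet> k + 1) / - (z \<bullet> k)"
  have yK: "y \<in> K" using y interior_subset by blast
  have "s * (z \<bullet> k) = - (y \<bullet> k + 1)" using k by (simp add: s_def)
  then have "(y + s *\<^sub>R z) \<bullet> k = -1" by (simp add: inner_add_left)
  then have out: "y + s *\<^sub>R z \<notin> K"
    using inner_nonneg[of "y + s *\<^sub>R z" k] k by auto
  have s: "s \<ge> 0"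
    unfolding s_def using k inner_nonneg[OF yK k(1)] by (intro divide_nonneg_pos) auto
  have "closed_segment y (y + s *\<^sub>R z) \<inter> frontier K \<noteq> {}"
    using yK out by (intro connected_Int_frontier) auto
  then obtain u where u: "0 \<le> u" "y + (u * s) *\<^sub>R z \<in> frontier K"
    by (auto simp: in_segment algebra_simps)
  have *: "y + (u * s) *\<^sub>R z \<in> K" "y + (u * s) *\<^sub>R z \<notin> interior K"
    using u(2) closed_cone by (auto simp: frontier_def)
  moreover have "u * s > 0"
    using *(2) y u(1) s by (metis add.right_neutral less_eq_real_def mult_nonneg_nonneg scaleR_zero_left)
  ultimately show thesis using that by blast
qed

text \<open>
  Optimality of strategies \<open>x, y\<close> with value \<open>v\<close> without quantifiers over opponents: by self-duality,
  membership in \<open>K\<close> says that \<open>x\<close> guarantees at least \<open>v\<close> and that \<open>y\<close> concedes at most \<open>v\<close>.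
\<close>

definition equilibrium :: "('a \<Rightarrow> 'a) \<Rightarrow> real \<Rightarrow> 'a \<Rightarrow> 'a \<Rightarrow> bool" where
  "equilibrium L v x y \<longleftrightarrow> x \<in> K \<and> x \<bullet> e = 1 \<and> y \<in> K \<and> y \<bullet> e = 1 \<and>
     L x - v *\<^sub>R e \<in> K \<and> v *\<^sub>R e - adjoint L y \<in> K"

lemma equilibrium_value_le:
  assumes "linear L" "equilibrium L v x y" "equilibrium L w x' y'"
  shows "v \<le> L x \<bullet> y'" "L x \<bullet> y' \<le> w"
proof -
  have pos: "0 \<le> (L x - v *\<^sub>R e) \<bullet> y'" "0 \<le> (w *\<^sub>R e - adjoint L y') \<bullet> x"
    using assms(2,3) by (auto simp: equilibrium_def intro: inner_nonneg)
  have unit: "e \<bullet> y' = 1" "e \<bullet> x = 1"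
    using assms(2,3) by (simp_all add: equilibrium_def inner_commute)
  show "v \<le> L x \<bullet> y'" using pos(1) by (simp add: inner_diff_left unit)
  show "L x \<bullet> y' \<le> w"
    using pos(2) by (simp add: inner_diff_left unit adjoint_clauses[OF assms(1)] inner_commute[of y'])
qed

text \<open>
  The minimax theorem. Let \<open>v\<close> be the least level that some strategy \<open>y\<close> can enforce; it is attained
  because the enforceable levels form a closed set. If no strategy \<open>x\<close> guaranteed \<open>v\<close>, a hyperplane
  would separate the compact convex set of all \<open>L x - v e\<close> from \<open>K\<close>. Since \<open>K\<close> is a self-dual cone,
  the normal vector \<open>z\<close> lies in \<open>K\<close>, and after normalization it is a strategy that enforces a level
  below \<open>v\<close>.
\<close>

lemma equilibrium_exists:
  assumes "linear L"
  shows "\<exists>v x y. equilibrium L v x y"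
proof -
  interpret A: linear "adjoint L" using assms by (rule adjoint_linear)
  define D where "D = {x \<in> K. x \<bullet> e = 1}"
  obtain m where m: "m > 0" "\<And>k. k \<in> K \<Longrightarrow> m * norm k \<le> e \<bullet> k"
    using positive_functional_coercive[of e] inner_unit_pos by (metis inner_commute)
  have D_le: "norm x \<le> 1 / m" if "x \<in> D" for x
    using m(2)[of x] m(1) that by (simp add: D_def inner_commute field_simps)
  then have "bounded D" by (auto simp: bounded_iff)
  moreover have "closed D"
    unfolding D_def Collect_conj_eq
    using closed_cone by (auto intro!: closed_Int closed_Collect_eq continuous_intros)
  ultimately have "compact D" by (simp add: compact_eq_bounded_closed)
  have normalize: "(1 / (k \<bullet> e)) *\<^sub>R k \<in> D" if "k \<in> K" "k \<noteq> 0" for k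
    using inner_unit_pos[OF that] that by (simp add: D_def cone_scale)
  then have "D \<noteq> {}" using unit_in_cone unit_nonzero by blast
  have "convex D"
    unfolding D_def convex_def
    by (auto simp: inner_add_left intro!: cone_add cone_scale)
  have memI: "x \<in> K" if "\<And>d. d \<in> D \<Longrightarrow> 0 \<le> x \<bullet> d" for x
  proof (rule cone_memI)
    fix k assume k: "k \<in> K"
    show "0 \<le> x \<bullet> k"
    proof (cases "k = 0")
      case False
      then show ?thesis
        using that[OF normalize[OF k False]] inner_unit_pos[OF k False]
        by (simp add: zero_le_divide_iff)
    qed simp
  qed
  obtain d0 where d0: "d0 \<in> D" using \<open>D \<noteq> {}\<close> by blast
  define W where "W = {w. \<exists>y\<in>D. w *\<^sub>R e - adjoint L y \<in> K}"
  have "W = (\<lambda>w. w *\<^sub>R e) -` (\<Union>a\<in>adjoint L ` D. \<Union>b\<in>K. {a + b})"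
  proof -
    have "w *\<^sub>R e - a \<in> K \<longleftrightarrow> (\<exists>b\<in>K. w *\<^sub>R e = a + b)" for w a
      by (metis add_diff_cancel_left' add.commute diff_add_cancel)
    then show ?thesis unfolding W_def by auto
  qed
  moreover have "closed (\<Union>a\<in>adjoint L ` D. \<Union>b\<in>K. {a + b})"
    using \<open>compact D\<close> closed_cone
    by (intro compact_closed_sums compact_continuous_image linear_continuous_on
        linear_conv_bounded_linear[THEN iffD1] A.linear_axioms)
  ultimately have "closed W"
    by (auto intro!: closed_vimage continuous_intros)
  moreover have "W \<noteq> {}"
  proof -
    have "(norm (adjoint L d0) / m) *\<^sub>R e - adjoint L d0 \<in> K"
    proof (rule cone_memI)
      fix k assume k: "k \<in> K"
      have "adjoint L d0 \<bullet> k \<le> norm (adjoint L d0) * norm k" by (rule norm_cauchy_schwarz)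
      also have "\<dots> \<le> (norm (adjoint L d0) / m) * (e \<bullet> k)"
        using m(1) mult_left_mono[OF m(2)[OF k], of "norm (adjoint L d0) / m"] by simp
      finally show "0 \<le> ((norm (adjoint L d0) / m) *\<^sub>R e - adjoint L d0) \<bullet> k"
        by (simp add: inner_diff_left)
    qed
    then show ?thesis using d0 by (auto simp: W_def)
  qed
  moreover have "bdd_below W"
  proof (rule bdd_belowI)
    fix w assume "w \<in> W"
    then obtain y where y: "y \<in> D" "w *\<^sub>R e - adjoint L y \<in> K" by (auto simp: W_def)
    have "0 \<le> (w *\<^sub>R e - adjoint L y) \<bullet> d0" using y(2) d0 by (auto simp: D_def intro: inner_nonneg)
    then have "L d0 \<bullet> y \<le> w"
      using d0
      by (simp add: D_def inner_diff_left adjoint_clauses[OF assms] inner_commute[of e]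
          inner_commute[of y])
    moreover have "- (norm (L d0) * norm y) \<le> L d0 \<bullet> y"
      using Cauchy_Schwarz_ineq2[of "L d0" y] by linarith
    moreover have "norm (L d0) * norm y \<le> norm (L d0) * (1 / m)"
      using D_le[OF y(1)] by (intro mult_left_mono) auto
    ultimately show "- (norm (L d0) * (1 / m)) \<le> w" by linarith
  qed
  ultimately have "Inf W \<in> W" by (intro closed_contains_Inf)
  define v where "v = Inf W"
  have v_least: "v \<le> w" if "w \<in> W" for w
    unfolding v_def using that \<open>bdd_below W\<close> by (rule cInf_lower)
  obtain y where y: "y \<in> D" "v *\<^sub>R e - adjoint L y \<in> K"
    using \<open>Inf W \<in> W\<close> by (auto simp: W_def v_def)
  have "\<exists>x\<in>D. L x - v *\<^sub>R e \<in> K"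
  proof (rule ccontr)
    assume none: "\<not> (\<exists>x\<in>D. L x - v *\<^sub>R e \<in> K)"
    define S where "S = (\<lambda>x. - (v *\<^sub>R e) + x) ` L ` D"
    have "convex S"
      unfolding S_def using \<open>convex D\<close> assms
      by (intro convex_translation convex_linear_image)
    moreover have "compact S"
      unfolding S_def using \<open>compact D\<close> assms
      by (intro compact_translation compact_continuous_image linear_continuous_on
          linear_conv_bounded_linear[THEN iffD1])
    moreover have "S \<inter> K = {}" using none by (auto simp: S_def)
    moreover have "S \<noteq> {}" using d0 by (auto simp: S_def)
    ultimately obtain z b where zS: "\<And>s. s \<in> S \<Longrightarrow> z \<bullet> s < b" and zK: "\<And>k. k \<in> K \<Longrightarrow> b < z \<bullet> k"
      using separating_hyperplane_compact_closed[of S K] convex_cone closed_cone by blast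
    have b: "b < 0" using zK[OF zero_in_cone] by simp
    have z: "z \<in> K"
    proof (rule cone_memI, rule ccontr)
      fix k assume k: "k \<in> K" and "\<not> 0 \<le> z \<bullet> k"
      then have "z \<bullet> k < 0" by simp
      then show False
        using zK[OF cone_scale[OF k, of "b / (z \<bullet> k)"]] b by (simp add: zero_le_divide_iff)
    qed
    have zL: "L x \<bullet> z - v * (z \<bullet> e) < b" if "x \<in> D" for x
    proof -
      have "- (v *\<^sub>R e) + L x \<in> S" unfolding S_def using that by blast
      from zS[OF this] show ?thesis
        by (simp add: inner_diff_right inner_commute[of z])
    qed
    have "z \<noteq> 0" using zL[OF d0] b by auto
    then have ze: "0 < z \<bullet> e" using z inner_unit_pos by blast
    define y' where "y' = (1 / (z \<bullet> e)) *\<^sub>R z"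
    have y': "y' \<in> D" unfolding y'_def using normalize z \<open>z \<noteq> 0\<close> by blast
    define w where "w = v + b / (z \<bullet> e)"
    have "w *\<^sub>R e - adjoint L y' \<in> K"
    proof (rule memI)
      fix d assume d: "d \<in> D"
      have "L d \<bullet> y' = (L d \<bullet> z) / (z \<bullet> e)" by (simp add: y'_def)
      also have "\<dots> \<le> w"
        using zL[OF d] ze by (simp add: w_def field_simps)
      finally show "0 \<le> (w *\<^sub>R e - adjoint L y') \<bullet> d"
        using d
        by (simp add: D_def inner_diff_left adjoint_clauses[OF assms] inner_commute[of e]
            inner_commute[of y'])
    qed
    then have "w \<in> W" using y' by (auto simp: W_def)
    moreover have "w < v" using b ze by (simp add: w_def divide_neg_pos)
    ultimately show False using v_least by force
  qed
  then show ?thesis using y by (auto simp: equilibrium_def D_def)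
qed

text \<open>
  The set \<open>C\<close> of all \<open>z\<close> with \<open>- L\<^sup>* z \<in> K\<close> is a convex cone that meets the boundary of \<open>K\<close> only in
  \<open>0\<close>. Since \<open>y0\<close> is interior, the ray from \<open>y0\<close> in the direction of any \<open>z \<in> C - K\<close> leaves \<open>K\<close> at a
  boundary point, which belongs to \<open>C\<close> and thus is \<open>0\<close>; so \<open>z\<close> is a multiple of \<open>y0\<close> (fact
  \<open>parallel\<close>). Applied to \<open>z\<close> or \<open>- z\<close> this puts the kernel of \<open>L\<^sup>*\<close> into the line through \<open>y0\<close>, and a
  dimension count makes the range of \<open>L\<^sup>*\<close> the full orthogonal complement of \<open>x0\<close>. A boundary
  point \<open>x0\<close> is orthogonal to some nonzero \<open>k \<in> K\<close>, and solving \<open>- L\<^sup>* z = k\<close> with \<open>z\<close> outside \<open>K\<close>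
  contradicts \<open>parallel\<close>.
\<close>

lemma maximizer_interior_if_minimizers_interior:
  assumes "linear L"
    and x0: "x0 \<in> K" "x0 \<noteq> 0" "L x0 \<in> K"
    and y0: "y0 \<in> K" "y0 \<noteq> 0" "- adjoint L y0 \<in> K"
    and interior: "\<And>y. \<lbrakk>y \<in> K; y \<noteq> 0; - adjoint L y \<in> K\<rbrakk> \<Longrightarrow> y \<in> interior K"
  shows "x0 \<in> interior K"
proof (rule ccontr)
  assume "x0 \<notin> interior K"
  then obtain k where k: "k \<in> K" "k \<noteq> 0" "x0 \<bullet> k = 0"
    using x0 not_interior_cone_orthogonal by blast
  interpret L: linear L by fact
  interpret A: linear "adjoint L" using assms(1) by (rule adjoint_linear)
  have y0_int: "y0 \<in> interior K" using interior y0 by blast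
  have parallel: "\<exists>r. z = r *\<^sub>R y0" if z: "z \<notin> K" "- adjoint L z \<in> K" for z
  proof -
    obtain t where t: "t > 0" "y0 + t *\<^sub>R z \<in> K" "y0 + t *\<^sub>R z \<notin> interior K"
      using ray_exits_cone[OF y0_int z(1)] .
    have "- adjoint L (y0 + t *\<^sub>R z) = - adjoint L y0 + t *\<^sub>R (- adjoint L z)"
      by (simp add: A.add A.scale)
    also have "\<dots> \<in> K" using y0 z t by (intro cone_add cone_scale) auto
    finally have "y0 + t *\<^sub>R z = 0" using interior[OF t(2)] t(3) by blast
    then have "t *\<^sub>R z = - y0" by (simp add: add_eq_0_iff)
    moreover have "z = (1 / t) *\<^sub>R (t *\<^sub>R z)" using t(1) by simp
    ultimately have "z = (- (1 / t)) *\<^sub>R y0" by simp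
    then show ?thesis by blast
  qed
  have kernel: "\<exists>r. z = r *\<^sub>R y0" if z: "adjoint L z = 0" for z
  proof (cases "z \<in> K \<and> - z \<in> K")
    case True
    then have "z = 0 *\<^sub>R y0" using pointed by simp
    then show ?thesis ..
  next
    case False
    then show ?thesis
      using parallel[of z] parallel[of "- z"] z zero_in_cone
      by (auto simp: A.neg) (metis minus_minus scaleR_minus_left)
  qed
  have "L x0 \<bullet> y0 = 0"
  proof -
    have "0 \<le> x0 \<bullet> - adjoint L y0" using x0 y0 by (intro inner_nonneg)
    then have "L x0 \<bullet> y0 \<le> 0" by (simp add: adjoint_works[OF assms(1)])
    then show ?thesis using inner_nonneg[OF x0(3) y0(1)] by simp
  qed
  then have Lx0: "L x0 = 0"
    using y0_int x0(3) by (force simp: mem_interior_cone_iff inner_commute)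
  have range: "range (adjoint L) \<subseteq> {y. x0 \<bullet> y = 0}"
    by (auto simp: adjoint_works[OF assms(1)] Lx0)
  let ?H = "{y. y0 \<bullet> y = 0}"
  have sH: "subspace ?H" by (rule subspace_hyperplane)
  have ker_H: "z = 0" if zH: "y0 \<bullet> z = 0" and z: "adjoint L z = 0" for z
    using kernel[OF z] zH y0(2) by auto
  have "inj_on (adjoint L) ?H"
  proof (intro inj_onI)
    fix a b assume "a \<in> ?H" "b \<in> ?H" "adjoint L a = adjoint L b"
    then have "y0 \<bullet> (a - b) = 0" "adjoint L (a - b) = 0"
      by (simp_all add: inner_diff_right A.diff)
    then have "a - b = 0" by (rule ker_H)
    then show "a = b" by simp
  qed
  then have "inj_on (adjoint L) (span ?H)"
    unfolding span_eq_iff[THEN iffD2, OF sH] .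
  from dim_image_eq[OF A.linear_axioms this]
  have "dim (adjoint L ` ?H) = DIM('a) - 1"
    unfolding dim_hyperplane[OF y0(2)] .
  then have "adjoint L ` ?H = {y. x0 \<bullet> y = 0}"
    using range dim_hyperplane[OF x0(2)]
    by (intro subspace_dim_equal linear_subspace_image[OF A.linear_axioms sH] subspace_hyperplane)
      (blast, simp)
  moreover have "k \<in> {y. x0 \<bullet> y = 0}" using k(3) by simp
  ultimately have "k \<in> adjoint L ` ?H" by simp
  then obtain w where w: "adjoint L w = k" by auto
  \<comment> \<open>subtracting \<open>s\<close> times the kernel vector \<open>y0\<close> pushes the solution of \<open>- L\<^sup>* z = k\<close> out of \<open>K\<close>\<close>
  define s where "s = (\<bar>y0 \<bullet> w\<bar> + 1) / (y0 \<bullet> y0)"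
  have "s * (y0 \<bullet> y0) = \<bar>y0 \<bullet> w\<bar> + 1" using y0(2) by (simp add: s_def)
  have Ay0: "adjoint L y0 = 0"
  proof -
    have "x0 \<notin> range (adjoint L)" using range x0(2) by auto
    then have "\<not> inj (adjoint L)"
      using linear_injective_imp_surjective[OF A.linear_axioms] by blast
    then obtain z where "adjoint L z = 0" "z \<noteq> 0"
      using A.inj_iff_eq_0 by blast
    moreover from this obtain r where "z = r *\<^sub>R y0" using kernel by blast
    ultimately show ?thesis by (auto simp: A.scale)
  qed
  define z where "z = - w - s *\<^sub>R y0"
  have "z \<bullet> y0 = - (y0 \<bullet> w) - s * (y0 \<bullet> y0)"
    by (simp add: z_def inner_diff_left inner_commute[of w])
  then have "z \<bullet> y0 < 0" using \<open>s * (y0 \<bullet> y0) = _\<close> by linarith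
  then have "z \<notin> K" using inner_nonneg[of z y0] y0(1) by linarith
  moreover have Az: "- adjoint L z = k"
    using Ay0 w by (simp add: z_def A.diff A.neg A.scale)
  ultimately obtain r where "z = r *\<^sub>R y0" using parallel k(1) by metis
  then have "adjoint L z = 0" using Ay0 by (simp add: A.scale)
  then show False using Az k(2) by simp
qed

end

section \<open>Values of games on the symmetric cone\<close>

context euclidean_jordan_algebra
begin

sublocale cone: self_dual_cone "symmetric_cone p" e
proof
  show "x \<in> symmetric_cone p \<longleftrightarrow> (\<forall>y\<in>symmetric_cone p. 0 \<le> x \<bullet> y)" for x
    by (rule symmetric_cone_self_dual)
  show "e \<in> symmetric_cone p"
    using unit[of e] by (intro idempotent_in_symmetric_cone) (simp add: idempotent_def)
  show "0 < k \<bullet> e" if k: "k \<in> symmetric_cone p" "k \<noteq> 0" for k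
  proof -
    obtain a where a: "k = p a a" using k by (auto simp: symmetric_cone_def)
    then have "a \<noteq> 0" using k square_eq_0_iff by blast
    then show ?thesis by (simp add: a inner_square_unit)
  qed
qed

text \<open>
  Every nonzero element of the cone is a positive multiple of a strategy, so inequalities tested
  against strategies are inequalities tested against the self-dual cone.
\<close>

lemma optimal_pair_iff_equilibrium:
  assumes "linear L"
  shows "optimal_pair p e L x y \<longleftrightarrow> (\<exists>v. cone.equilibrium L v x y)"
proof
  assume opt: "optimal_pair p e L x y"
  define v where "v = L x \<bullet> y"
  have xy: "x \<in> symmetric_cone p" "x \<bullet> e = 1" "y \<in> symmetric_cone p" "y \<bullet> e = 1"
    using opt by (auto simp: optimal_pair_def strategies_def)
  have norm: "(1 / (k \<bullet> e)) *\<^sub>R k \<in> strategies p e" if "k \<in> symmetric_cone p" "k \<noteq> 0" for k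
    using cone.inner_unit_pos[OF that] that by (simp add: strategies_def cone.cone_scale)
  have le: "v \<le> L x \<bullet> d" "L d \<bullet> y \<le> v" if "d \<in> strategies p e" for d
    using opt that unfolding optimal_pair_def v_def by blast+
  interpret L: linear L by fact
  have "L x - v *\<^sub>R e \<in> symmetric_cone p"
  proof (rule cone.cone_memI)
    fix k assume k: "k \<in> symmetric_cone p"
    show "0 \<le> (L x - v *\<^sub>R e) \<bullet> k"
    proof (cases "k = 0")
      case False
      then show ?thesis
        using le(1)[OF norm[OF k False]] cone.inner_unit_pos[OF k False]
        by (simp add: inner_diff_left inner_commute[of e] field_simps)
    qed simp
  qed
  moreover have "v *\<^sub>R e - adjoint L y \<in> symmetric_cone p"
  proof (rule cone.cone_memI)
    fix k assume k: "k \<in> symmetric_cone p"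
    show "0 \<le> (v *\<^sub>R e - adjoint L y) \<bullet> k"
    proof (cases "k = 0")
      case False
      then show ?thesis
        using le(2)[OF norm[OF k False]] cone.inner_unit_pos[OF k False]
        by (simp add: inner_diff_left inner_commute[of e] inner_commute[of y] L.scale
            adjoint_clauses[OF assms] field_simps)
    qed simp
  qed
  ultimately show "\<exists>v. cone.equilibrium L v x y"
    using xy unfolding cone.equilibrium_def by blast
next
  assume "\<exists>v. cone.equilibrium L v x y"
  then obtain v where v: "cone.equilibrium L v x y" by blast
  then have xy: "x \<in> strategies p e" "y \<in> strategies p e"
    by (auto simp: cone.equilibrium_def strategies_def)
  have pay: "v \<le> L x \<bullet> d" "L d \<bullet> y \<le> v" if "d \<in> strategies p e" for d
  proof -
    have d: "d \<in> symmetric_cone p" "e \<bullet> d = 1"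
      using that by (auto simp: strategies_def inner_commute)
    have "0 \<le> (L x - v *\<^sub>R e) \<bullet> d" "0 \<le> (v *\<^sub>R e - adjoint L y) \<bullet> d"
      using v d by (auto simp: cone.equilibrium_def intro: cone.inner_nonneg)
    then show "v \<le> L x \<bullet> d" "L d \<bullet> y \<le> v"
      by (simp_all add: inner_diff_left d adjoint_clauses[OF assms] inner_commute[of y])
  qed
  have "L x \<bullet> y = v" using pay(1)[OF xy(2)] pay(2)[OF xy(1)] by simp
  then show "optimal_pair p e L x y"
    using xy pay by (simp add: optimal_pair_def)
qed

lemma game_value_equilibrium:
  assumes "linear L" "cone.equilibrium L v x y"
  shows "game_value p e L = v"
proof -
  have payoff: "L x' \<bullet> y' = v" if "cone.equilibrium L w x' y'" for w x' y'
    using cone.equilibrium_value_le[OF assms(1) assms(2) that]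
      cone.equilibrium_value_le[OF assms(1) that assms(2)]
      cone.equilibrium_value_le[OF assms(1) that that] by linarith
  show ?thesis
    unfolding game_value_def optimal_pair_iff_equilibrium[OF assms(1)]
  proof (rule the_equality)
    show "\<exists>x' y'. (\<exists>v. cone.equilibrium L v x' y') \<and> v = L x' \<bullet> y'"
      using assms(2) payoff[OF assms(2)] by (intro exI[of _ x] exI[of _ y]) auto
    show "u = v" if "\<exists>x' y'. (\<exists>v. cone.equilibrium L v x' y') \<and> u = L x' \<bullet> y'" for u
      using that payoff by blast
  qed
qed

lemma completely_mixed_iff_equilibrium:
  assumes "linear L" "game_value p e L = v"
  shows "completely_mixed p e L \<longleftrightarrow> (\<forall>x y. cone.equilibrium L v x y \<longrightarrow>
    x \<in> interior (symmetric_cone p) \<and> y \<in> interior (symmetric_cone p))"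
  unfolding completely_mixed_def optimal_pair_iff_equilibrium[OF assms(1)]
  using game_value_equilibrium[OF assms(1)] assms(2) by blast

lemma linear_quad_rep_primitive:
  "primitive_idempotent p c \<Longrightarrow> linear (quad_rep p c)"
  by (rule linearI) (simp_all add: quad_rep_primitive inner_add_left add_divide_distrib scaleR_left_distrib)

lemma adjoint_add_quad_rep_primitive:
  assumes "linear L" "primitive_idempotent p c"
  shows "adjoint (\<lambda>x. L x + quad_rep p c x) y = adjoint L y + quad_rep p c y"
proof -
  have "adjoint (\<lambda>x. L x + quad_rep p c x) = (\<lambda>y. adjoint L y + quad_rep p c y)"
  proof (rule adjoint_unique, intro allI)
    fix x y
    show "(L x + quad_rep p c x) \<bullet> y = x \<bullet> (adjoint L y + quad_rep p c y)"
      by (simp add: quad_rep_primitive[OF assms(2)] inner_add_left inner_add_right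
          adjoint_works[OF assms(1)] inner_commute[of c y])
  qed
  then show ?thesis by simp
qed

text \<open>
  If the perturbed value were at most \<open>0\<close>, an optimal \<open>y\<close> of the perturbed game would be optimal for
  \<open>L\<close> as well, hence interior; the excess \<open>P\<^sub>c y\<close> then pairs positively with an interior optimal \<open>x\<close>,
  contradicting \<open>\<langle>x, - L\<^sup>* y - P\<^sub>c y\<rangle> \<ge> 0\<close>.
\<close>

lemma completely_mixed_imp_value_pos:
  assumes L: "linear L" and v0: "game_value p e L = 0" and cm: "completely_mixed p e L"
    and c: "primitive_idempotent p c"
  shows "game_value p e (\<lambda>x. L x + quad_rep p c x) > 0"
proof (rule ccontr)
  let ?K = "symmetric_cone p" and ?A = "\<lambda>x. L x + quad_rep p c x"
  assume "\<not> game_value p e ?A > 0"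
  have A: "linear ?A" using L linear_quad_rep_primitive[OF c] by (rule linear_compose_add)
  obtain w u y where A_eq: "cone.equilibrium ?A w u y" using cone.equilibrium_exists[OF A] by blast
  then have w: "w \<le> 0" using game_value_equilibrium[OF A] \<open>\<not> _\<close> by force
  obtain x z where "cone.equilibrium L 0 x z"
    using cone.equilibrium_exists[OF L] game_value_equilibrium[OF L] v0 by metis
  then have x: "x \<in> ?K" "x \<bullet> e = 1" "L x \<in> ?K"
    by (auto simp: cone.equilibrium_def)
  have y: "y \<in> ?K" "y \<bullet> e = 1" "w *\<^sub>R e - adjoint ?A y \<in> ?K"
    using A_eq by (auto simp: cone.equilibrium_def)
  have c0: "c \<in> ?K" "c \<noteq> 0"
    using c idempotent_in_symmetric_cone by (auto simp: primitive_idempotent_def)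
  have "(w *\<^sub>R e - adjoint ?A y) + (- w) *\<^sub>R e \<in> ?K"
    using y(3) w cone.unit_in_cone by (intro cone.cone_add cone.cone_scale) auto
  then have nA: "- adjoint L y - quad_rep p c y \<in> ?K"
    by (simp add: adjoint_add_quad_rep_primitive[OF L c])
  have "quad_rep p c y \<in> ?K"
    unfolding quad_rep_primitive[OF c]
    using cone.inner_nonneg[OF y(1) c0(1)] c0(1) by (intro cone.cone_scale) auto
  from cone.cone_add[OF nA this] have "- adjoint L y \<in> ?K" by simp
  then have "cone.equilibrium L 0 x y"
    using x y by (simp add: cone.equilibrium_def)
  then have int: "x \<in> interior ?K" "y \<in> interior ?K"
    using cm completely_mixed_iff_equilibrium[OF L v0] by auto
  then have pos: "0 < x \<bullet> c" "0 < y \<bullet> c"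
    using c0 by (auto simp: cone.mem_interior_cone_iff)
  have "0 \<le> x \<bullet> (- adjoint L y - quad_rep p c y)"
    using x(1) nA by (rule cone.inner_nonneg)
  also have "\<dots> = - (L x \<bullet> y) - (y \<bullet> c) / (c \<bullet> c) * (x \<bullet> c)"
    by (simp add: inner_diff_right adjoint_works[OF L] quad_rep_primitive[OF c])
  finally have "(y \<bullet> c) / (c \<bullet> c) * (x \<bullet> c) \<le> 0"
    using cone.inner_nonneg[OF x(3) y(1)] by linarith
  moreover have "0 < (y \<bullet> c) / (c \<bullet> c) * (x \<bullet> c)" using pos c0 by simp
  ultimately show False by linarith
qed

text \<open>
  A boundary minimizer is orthogonal to some primitive idempotent \<open>c\<close>, so it is annihilated by the
  perturbation \<open>P\<^sub>c\<close> and keeps the perturbed value at or below \<open>0\<close>.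
\<close>

lemma value_pos_imp_minimizer_interior:
  assumes L: "linear L"
    and pos: "\<And>c. primitive_idempotent p c \<Longrightarrow> game_value p e (\<lambda>x. L x + quad_rep p c x) > 0"
    and y: "y \<in> symmetric_cone p" "y \<noteq> 0" "- adjoint L y \<in> symmetric_cone p"
  shows "y \<in> interior (symmetric_cone p)"
proof (rule ccontr)
  assume "y \<notin> interior (symmetric_cone p)"
  then obtain k where "k \<in> symmetric_cone p" "k \<noteq> 0" "y \<bullet> k = 0"
    by (rule cone.not_interior_cone_orthogonal[OF y(1)])
  then obtain c where c: "primitive_idempotent p c" "y \<bullet> c = 0"
    by (rule primitive_idempotent_orthogonal[OF y(1)])
  let ?A = "\<lambda>x. L x + quad_rep p c x"
  have A: "linear ?A" using L linear_quad_rep_primitive[OF c(1)] by (rule linear_compose_add)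
  obtain w u z where eq: "cone.equilibrium ?A w u z" using cone.equilibrium_exists[OF A] by blast
  then have w: "w > 0" using game_value_equilibrium[OF A] pos[OF c(1)] by force
  have "adjoint ?A y = adjoint L y"
    unfolding adjoint_add_quad_rep_primitive[OF L c(1)] by (simp add: quad_rep_primitive[OF c(1)] c(2))
  then have "0 \<le> u \<bullet> - adjoint ?A y"
    using eq y(3) by (intro cone.inner_nonneg) (auto simp: cone.equilibrium_def)
  then have "?A u \<bullet> y \<le> 0" by (simp add: adjoint_works[OF A])
  moreover have "0 \<le> (?A u - w *\<^sub>R e) \<bullet> y"
    using eq y(1) by (intro cone.inner_nonneg) (auto simp: cone.equilibrium_def)
  moreover have "0 < w * (e \<bullet> y)"
    using w cone.inner_unit_pos[OF y(1,2)] by (simp add: inner_commute)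
  ultimately show False by (simp add: inner_diff_left)
qed

lemma value_pos_imp_completely_mixed:
  assumes L: "linear L" and v0: "game_value p e L = 0"
    and pos: "\<And>c. primitive_idempotent p c \<Longrightarrow> game_value p e (\<lambda>x. L x + quad_rep p c x) > 0"
  shows "completely_mixed p e L"
  unfolding completely_mixed_iff_equilibrium[OF L v0]
proof (intro allI impI)
  fix x y assume "cone.equilibrium L 0 x y"
  then have x: "x \<in> symmetric_cone p" "x \<noteq> 0" "L x \<in> symmetric_cone p"
    and y: "y \<in> symmetric_cone p" "y \<noteq> 0" "- adjoint L y \<in> symmetric_cone p"
    by (auto simp: cone.equilibrium_def)
  note int = value_pos_imp_minimizer_interior[OF L pos]
  show "x \<in> interior (symmetric_cone p) \<and> y \<in> interior (symmetric_cone p)"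
    using cone.maximizer_interior_if_minimizers_interior[OF L x y int] int[OF _ y] by blast
qed

end

theorem theorem4p2:
  fixes p :: "'a::euclidean_space \<Rightarrow> 'a \<Rightarrow> 'a" and e :: 'a and L :: "'a \<Rightarrow> 'a"
  assumes "euclidean_jordan_algebra p e"
    and "trace_inner_product p e"
    and "linear L"
    and "game_value p e L = 0"
  shows "completely_mixed p e L \<longleftrightarrow>
    (\<forall>c. primitive_idempotent p c \<longrightarrow> game_value p e (\<lambda>x. L x + quad_rep p c x) > 0)"
proof -
  interpret euclidean_jordan_algebra p e by fact
  show ?thesis
    using completely_mixed_imp_value_pos[OF assms(3,4)]
      value_pos_imp_completely_mixed[OF assms(3,4)] by blast
qed

end
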